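(* Let $f(x)=\sum_{k=0}^{\infty}x^k a_k\in \mathcal{SRB}(\mathbb{B})$ with $a_k\in\mathbb{O}$. Then for every $J\in\mathbb{S}$ and every $x\in\mathbb{B}_J$ with $|x|\le \frac13$, $$\mathcal{F}^*_f(|x|):=\sum_{n=0}^{\infty}|x|^n\left(\sum_{k=0}^{n}\left|a_k e^{-\frac{2\pi J nk}{n+1}}\right|\right)\le\frac{1}{1-|x|}.$$ The constant $1/3$ cannot be improved, i.e. for every $r\in(1/3,1)$ there exists $f\in\mathcal{SRB}(\mathbb{B})$ for which this inequality fails for $|x|=r$.
   Context: $\mathbb{O}$ is the real algebra of octonions, $\mathbb{O}=\mathbb{H}+l\mathbb{H}$ ($\mathbb{H}$ the quaternions) with $\overline{a+lb}=\overline a-lb$ and $(a+lb)(c+ld)=(ac-d\overline b)+l(\overline a d+cb)$, a non-commutative, non-associative, alternative division algebra. $|x|=\sqrt{x\overline x}$ is the Euclidean norm on $\mathbb{R}^8$; it is multiplicative. $\mathbb{B}=\{x\in\mathbb{O}:|x|<1\}$, $\mathbb{S}=\{I\in\mathbb{O}:I^2=-1\}$, and $\mathbb{D}$ is the open unit disk of $\mathbb{C}$. For $J\in\mathbb{S}$, $\mathbb{C}_J=\mathbb{R}+\mathbb{R}J\cong\mathbb{C}$ and $\mathbb{B}_J=\mathbb{B}\cap\mathbb{C}_J$; for real $\theta$, $e^{J\theta}=\cos\theta+J\sin\theta$. Slice regular functions on $\mathbb{B}$: a stem function on $\mathbb{D}$ is $F=F_1+iF_2:\mathbb{D}\to\mathbb{O}\otimes_{\mathbb{R}}\mathbb{C}$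 with $\mathbb{O}$-valued components satisfying $F_1(\overline z)=F_1(z)$, $F_2(\overline z)=-F_2(z)$. It induces the slice function $f:\mathbb{B}\to\mathbb{O}$, $f(\alpha+I\beta)=F_1(\alpha+i\beta)+I F_2(\alpha+i\beta)$ for $I\in\mathbb{S}$ and real $\alpha,\beta$ with $\alpha+i\beta\in\mathbb{D}$. The function $f$ is slice regular if $F$ is $C^1$ and satisfies the Cauchy–Riemann equations $\partial_\alpha F_1=\partial_\beta F_2$, $\partial_\beta F_1=-\partial_\alpha F_2$ on $\mathbb{D}$. Every slice regular function on $\mathbb{B}$ has a convergent power series expansion $f(x)=\sum_{k=0}^\infty x^k a_k$ with $a_k\in\mathbb{O}$. $\mathcal{SRB}(\mathbb{B})$ is the class of slice regular functions $f$ on $\mathbb{B}$ with $|f(x)|\le 1$ for all $x\in\mathbb{B}$. $\mathcal{F}^*_f(|x|)$ is the majorant series of the discrete Fourier transform $\mathcal{F}^*[f](x)=\sum_{n=0}^\infty x^n\left(\sum_{k=0}^n a_k e^{-2\pi Jnk/(n+1)}\right)$, $x\in\mathbb{B}_J$. *)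

theory Defs
  imports "HOL-Analysis.Analysis"
begin

section \<open>Quaternions\<close>

text \<open>
  \<open>Quat a b c d\<close> stands for \<open>a + bi + cj + dk\<close>.
\<close>

datatype quat = Quat (q0: real) (q1: real) (q2: real) (q3: real)

instantiation quat :: ring_1
begin

definition "0 = Quat 0 0 0 0"

definition "1 = Quat 1 0 0 0"

definition "x + y = Quat (q0 x + q0 y) (q1 x + q1 y) (q2 x + q2 y) (q3 x + q3 y)"

definition "- x = Quat (- q0 x) (- q1 x) (- q2 x) (- q3 x)"

definition "x - y = Quat (q0 x - q0 y) (q1 x - q1 y) (q2 x - q2 y) (q3 x - q3 y)"

definition
  "x * y = Quat
     (q0 x * q0 y - q1 x * q1 y - q2 x * q2 y - q3 x * q3 y)
     (q0 x * q1 y + q1 x * q0 y + q2 x * q3 y - q3 x * q2 y)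
     (q0 x * q2 y - q1 x * q3 y + q2 x * q0 y + q3 x * q1 y)
     (q0 x * q3 y + q1 x * q2 y - q2 x * q1 y + q3 x * q0 y)"

lemmas quat_ops = zero_quat_def one_quat_def plus_quat_def uminus_quat_def
  minus_quat_def times_quat_def

instance
  by standard (auto simp: quat_ops algebra_simps)

end

definition quat_cnj :: "quat \<Rightarrow> quat" where
  "quat_cnj x = Quat (q0 x) (- q1 x) (- q2 x) (- q3 x)"

definition quat_scale :: "real \<Rightarrow> quat \<Rightarrow> quat" where
  "quat_scale r x = Quat (r * q0 x) (r * q1 x) (r * q2 x) (r * q3 x)"


section \<open>Octonions\<close>

text \<open>
  \<open>Octo a b\<close> stands for \<open>a + lb\<close>. The product is not associative, so the type is an
  instance of the syntactic class \<open>power\<close> only; there \<open>x ^ Suc n\<close> is \<open>x * x ^ n\<close>, the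
  bracketing being immaterial because the algebra is alternative.
\<close>

datatype octo = Octo (oct_a: quat) (oct_b: quat)

instantiation octo :: "{ab_group_add, power}"
begin

definition "0 = Octo 0 0"

definition "1 = Octo 1 0"

definition "x + y = Octo (oct_a x + oct_a y) (oct_b x + oct_b y)"

definition "- x = Octo (- oct_a x) (- oct_b x)"

definition "x - y = Octo (oct_a x - oct_a y) (oct_b x - oct_b y)"

definition
  "x * y = Octo
     (oct_a x * oct_a y - oct_b y * quat_cnj (oct_b x))
     (quat_cnj (oct_a x) * oct_b y + oct_a y * oct_b x)"

lemmas octo_ops = zero_octo_def one_octo_def plus_octo_def uminus_octo_def
  minus_octo_def times_octo_def

instance
  by standard (auto simp: octo_ops algebra_simps)

end

definition octo_cnj :: "octo \<Rightarrow> octo" where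
  "octo_cnj x = Octo (quat_cnj (oct_a x)) (- oct_b x)"

definition octo_Re :: "octo \<Rightarrow> real" where
  "octo_Re x = q0 (oct_a x)"

instantiation octo :: real_vector
begin

definition "scaleR r x = Octo (quat_scale r (oct_a x)) (quat_scale r (oct_b x))"

instance
  by standard (auto simp: scaleR_octo_def quat_scale_def octo_ops quat_ops algebra_simps)

end

text \<open>
  The norm is \<open>|x| = sqrt (x * octo_cnj x)\<close>; the product under the root is real (lemma
  \<open>octo_mult_cnj\<close> below), and the square root is taken of its real part.
\<close>

instantiation octo :: real_inner
begin

definition "inner x y = octo_Re (x * octo_cnj y)"

definition "norm x = sqrt (octo_Re (x * octo_cnj x))"

definition "sgn x = x /\<^sub>R norm x" for x :: octo

definition "dist x y = norm (x - y)" for x y :: octo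

definition
  "(uniformity :: (octo \<times> octo) filter) = (INF e\<in>{0 <..}. principal {(x, y). dist x y < e})"

definition
  "open (U :: octo set) \<longleftrightarrow> (\<forall>x\<in>U. eventually (\<lambda>(x', y). x' = x \<longrightarrow> y \<in> U) uniformity)"

lemmas octo_inner_ops = octo_ops quat_ops scaleR_octo_def inner_octo_def norm_octo_def
  octo_Re_def octo_cnj_def quat_cnj_def quat_scale_def

instance
proof
  fix x y z :: octo and r :: real
  have inner_self: "inner x x = (q0 (oct_a x))\<^sup>2 + (q1 (oct_a x))\<^sup>2 + (q2 (oct_a x))\<^sup>2
      + (q3 (oct_a x))\<^sup>2 + (q0 (oct_b x))\<^sup>2 + (q1 (oct_b x))\<^sup>2 + (q2 (oct_b x))\<^sup>2
      + (q3 (oct_b x))\<^sup>2"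
    by (simp add: octo_inner_ops power2_eq_square)
  show "0 \<le> inner x x"
    unfolding inner_self by simp
  show "inner x x = 0 \<longleftrightarrow> x = 0"
  proof
    assume "inner x x = 0"
    then have "oct_a x = Quat 0 0 0 0 \<and> oct_b x = Quat 0 0 0 0"
      unfolding inner_self by (simp add: add_nonneg_eq_0_iff quat.expand)
    then show "x = 0"
      by (simp add: octo.expand octo_ops quat_ops)
  qed (simp add: octo_inner_ops)
qed (auto simp: sgn_octo_def dist_octo_def uniformity_octo_def open_octo_def octo_inner_ops
      algebra_simps)

end

lemma Octo_conv_l: "Octo a b = Octo a 0 + Octo 0 1 * Octo b 0"
  by (simp add: octo_ops quat_cnj_def zero_quat_def[symmetric])

lemma octo_mult_cnj: "x * octo_cnj x = (norm x)\<^sup>2 *\<^sub>R 1" for x :: octo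
proof -
  have "(norm x)\<^sup>2 = octo_Re (x * octo_cnj x)"
    unfolding power2_norm_eq_inner by (simp add: inner_octo_def)
  then show ?thesis
    by (simp add: octo_inner_ops algebra_simps)
qed


section \<open>Slices\<close>

abbreviation octo_ball :: "octo set" where
  "octo_ball \<equiv> {x. norm x < 1}"

definition octo_units :: "octo set" where
  "octo_units = {I. I ^ 2 = - 1}"

definition octo_slice :: "octo \<Rightarrow> octo set" where
  "octo_slice J = {\<alpha> *\<^sub>R 1 + \<beta> *\<^sub>R J |\<alpha> \<beta>. True}"

text \<open>\<open>octo_cis J \<theta>\<close> is the exponential of \<open>J\<theta>\<close>.\<close>

definition octo_cis :: "octo \<Rightarrow> real \<Rightarrow> octo" where
  "octo_cis J \<theta> = cos \<theta> *\<^sub>R 1 + sin \<theta> *\<^sub>R J"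


section \<open>Slice regular functions\<close>

abbreviation cdisk :: "complex set" where
  "cdisk \<equiv> {z. cmod z < 1}"

text \<open>A stem function \<open>F1 + iF2\<close> is given by its pair of octonion-valued components.\<close>

definition stem_function :: "(complex \<Rightarrow> octo) \<Rightarrow> (complex \<Rightarrow> octo) \<Rightarrow> bool" where
  "stem_function F1 F2 \<longleftrightarrow> (\<forall>z\<in>cdisk. F1 (cnj z) = F1 z \<and> F2 (cnj z) = - F2 z)"

definition induces :: "(complex \<Rightarrow> octo) \<Rightarrow> (complex \<Rightarrow> octo) \<Rightarrow> (octo \<Rightarrow> octo) \<Rightarrow> bool" where
  "induces F1 F2 f \<longleftrightarrow> (\<forall>I\<in>octo_units. \<forall>\<alpha> \<beta>. Complex \<alpha> \<beta> \<in> cdisk \<longrightarrow>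
     f (\<alpha> *\<^sub>R 1 + \<beta> *\<^sub>R I) = F1 (Complex \<alpha> \<beta>) + I * F2 (Complex \<alpha> \<beta>))"

text \<open>Meant for open \<open>S\<close>.\<close>

definition C1_on :: "'a::real_normed_vector set \<Rightarrow> ('a \<Rightarrow> 'b::real_normed_vector) \<Rightarrow> bool" where
  "C1_on S F \<longleftrightarrow>
     (\<exists>F'. (\<forall>z\<in>S. (F has_derivative blinfun_apply (F' z)) (at z)) \<and> continuous_on S F')"

definition d_alpha :: "(complex \<Rightarrow> octo) \<Rightarrow> complex \<Rightarrow> octo" where
  "d_alpha F z = vector_derivative (\<lambda>t. F (Complex t (Im z))) (at (Re z))"

definition d_beta :: "(complex \<Rightarrow> octo) \<Rightarrow> complex \<Rightarrow> octo" where
  "d_beta F z = vector_derivative (\<lambda>t. F (Complex (Re z) t)) (at (Im z))"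

definition cauchy_riemann :: "(complex \<Rightarrow> octo) \<Rightarrow> (complex \<Rightarrow> octo) \<Rightarrow> bool" where
  "cauchy_riemann F1 F2 \<longleftrightarrow>
     (\<forall>z\<in>cdisk. d_alpha F1 z = d_beta F2 z \<and> d_beta F1 z = - d_alpha F2 z)"

text \<open>Functions on the unit ball are total functions whose values elsewhere are ignored.\<close>

definition slice_regular :: "(octo \<Rightarrow> octo) \<Rightarrow> bool" where
  "slice_regular f \<longleftrightarrow> (\<exists>F1 F2. stem_function F1 F2 \<and> C1_on cdisk F1 \<and> C1_on cdisk F2 \<and>
     cauchy_riemann F1 F2 \<and> induces F1 F2 f)"

definition SRB :: "(octo \<Rightarrow> octo) set" where
  "SRB = {f. slice_regular f \<and> (\<forall>x\<in>octo_ball. norm (f x) \<le> 1)}"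

definition has_expansion :: "(octo \<Rightarrow> octo) \<Rightarrow> (nat \<Rightarrow> octo) \<Rightarrow> bool" where
  "has_expansion f a \<longleftrightarrow> (\<forall>x\<in>octo_ball. (\<lambda>k. x ^ k * a k) sums f x)"

definition dft_majorant_term :: "octo \<Rightarrow> (nat \<Rightarrow> octo) \<Rightarrow> real \<Rightarrow> nat \<Rightarrow> real" where
  "dft_majorant_term J a r n =
     r ^ n * (\<Sum>k\<le>n. norm (a k * octo_cis J (- (2 * pi * real n * real k / (real n + 1)))))"

end

theory Submission
  imports Defs "HOL-Complex_Analysis.Complex_Analysis"
begin

text \<open>
  The octonion norm is multiplicative, so the exponential factors do not change the moduli and the
  majorant series is the Cauchy product of \<open>\<Sum>n. |a n| r^n\<close> with the geometric
  series. The claim thus reduces to Bohr's inequality \<open>\<Sum>n. |a n| r^n \<le> 1\<close>, and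
  for \<open>r \<le> 1/3\<close> this follows from \<open>|a k| \<le> 2 (1 - |a 0|)\<close>.

  To bound \<open>a k\<close>, let \<open>u\<close> be the direction of \<open>a 0\<close> and
  \<open>b n = u * octo_cnj (a n)\<close>. Then \<open>inner (x^n * a n) u = inner (x^n) (b n)\<close>, with no
  need of associativity. On the slice through \<open>b k\<close> the function \<open>inner (f x) u\<close> is the
  real part of a complex power series whose coefficients of index \<open>0\<close> and \<open>k\<close> have
  moduli \<open>|a 0|\<close> and \<open>|a k|\<close>; this real part is at most \<open>1\<close>, so Caratheodory's
  coefficient inequality applies.

  The Moebius maps \<open>(p - z) / (1 - p z)\<close> with real \<open>p\<close> near \<open>1\<close>, extended from the
  disk to the octonion ball, show that \<open>1/3\<close> is optimal.
\<close>

subsection \<open>Octonion arithmetic and slices\<close>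

lemma octo_eq_iff:
  "x = y \<longleftrightarrow> q0 (oct_a x) = q0 (oct_a y) \<and> q1 (oct_a x) = q1 (oct_a y)
    \<and> q2 (oct_a x) = q2 (oct_a y) \<and> q3 (oct_a x) = q3 (oct_a y)
    \<and> q0 (oct_b x) = q0 (oct_b y) \<and> q1 (oct_b x) = q1 (oct_b y)
    \<and> q2 (oct_b x) = q2 (oct_b y) \<and> q3 (oct_b x) = q3 (oct_b y)" for x y :: octo
  by (metis octo.expand quat.expand)

text \<open>Right multiplication by \<open>octo_cnj y\<close> is the adjoint of right multiplication
  by \<open>y\<close>; no associativity is involved, as expanding both sides in the eight
  coordinates shows.\<close>

lemma octo_inner_mult: "inner (x * y) z = inner x (z * octo_cnj y)" for x y z :: octo
  by (simp add: octo_inner_ops algebra_simps)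

lemma octo_inner_self:
  "inner x x = (q0 (oct_a x))\<^sup>2 + (q1 (oct_a x))\<^sup>2 + (q2 (oct_a x))\<^sup>2
      + (q3 (oct_a x))\<^sup>2 + (q0 (oct_b x))\<^sup>2 + (q1 (oct_b x))\<^sup>2 + (q2 (oct_b x))\<^sup>2
      + (q3 (oct_b x))\<^sup>2" for x :: octo
  by (simp add: octo_inner_ops power2_eq_square)

text \<open>This is the one trace of alternativity needed for the norm: with the adjoint rule it
  yields |xy|^2 = <x, (xy) cnj y> = |x|^2 |y|^2.\<close>

lemma octo_mult_mult_cnj: "(x * y) * octo_cnj y = inner y y *\<^sub>R x" for x y :: octo
  unfolding octo_inner_self
  by (simp add: octo_eq_iff octo_ops quat_ops scaleR_octo_def octo_cnj_def quat_cnj_def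
      quat_scale_def power2_eq_square) (simp add: algebra_simps)

lemma octo_norm_mult: "norm (x * y) = norm x * norm y" for x y :: octo
proof -
  have "(norm (x * y))\<^sup>2 = (norm x * norm y)\<^sup>2"
    by (simp add: power_mult_distrib power2_norm_eq_inner octo_inner_mult octo_mult_mult_cnj)
  then show ?thesis by (simp add: power2_eq_iff_nonneg)
qed

lemma octo_norm_one [simp]: "norm (1::octo) = 1"
  by (simp add: octo_inner_ops)

lemma octo_norm_cnj [simp]: "norm (octo_cnj x) = norm x"
  by (simp add: octo_inner_ops algebra_simps)

lemma octo_mult_one [simp]: "x * 1 = x" "1 * x = x" for x :: octo
  by (simp_all add: octo_eq_iff octo_ops quat_ops quat_cnj_def)

text \<open>The quadratic equation of an octonion, with \<open>inner 1 x\<close> its real part and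
  \<open>inner x x\<close> its squared norm.\<close>

lemma octo_mult_self: "x * x = (2 * inner 1 x) *\<^sub>R x - inner x x *\<^sub>R 1" for x :: octo
  by (simp add: octo_eq_iff octo_inner_ops algebra_simps)

lemma bounded_bilinear_octo_mult: "bounded_bilinear ((*) :: octo \<Rightarrow> octo \<Rightarrow> octo)"
proof
  show "\<exists>K. \<forall>a b::octo. norm (a * b) \<le> norm a * norm b * K"
    by (rule exI[of _ 1]) (simp add: octo_norm_mult)
qed (simp_all add: octo_eq_iff octo_ops quat_ops scaleR_octo_def quat_cnj_def
      quat_scale_def algebra_simps)

interpretation octo_mult: bounded_bilinear "(*) :: octo \<Rightarrow> octo \<Rightarrow> octo"
  by (rule bounded_bilinear_octo_mult)

text \<open>By the quadratic equation, the square roots of -1 form the unit sphere of the purely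
  imaginary octonions.\<close>

lemma octo_units_iff: "I \<in> octo_units \<longleftrightarrow> inner 1 I = 0 \<and> norm I = 1"
proof
  assume "I \<in> octo_units"
  then have sq: "I * I = - 1"
    by (simp add: octo_units_def numeral_2_eq_2)
  have "norm I * norm I = 1"
    using arg_cong[OF sq, of norm] by (simp add: octo_norm_mult)
  then have n: "norm I = 1"
    by (simp add: power2_eq_square[symmetric] power2_eq_1_iff norm_minus_cancel)
       (metis norm_ge_zero le_minus_one_simps(3))
  then have "inner 1 I *\<^sub>R I = 0"
    using octo_mult_self[of I] sq by (simp add: dot_square_norm)
  with n show "inner 1 I = 0 \<and> norm I = 1"
    by auto
next
  assume "inner 1 I = 0 \<and> norm I = 1"
  then show "I \<in> octo_units"
    using octo_mult_self[of I] by (simp add: octo_units_def numeral_2_eq_2 dot_square_norm)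
qed

lemma octo_units_nonempty: "\<exists>I. I \<in> octo_units"
  by (rule exI[of _ "Octo (Quat 0 1 0 0) 0"]) (simp add: octo_units_iff octo_inner_ops)

lemma obtain_octo_unit:
  obtains I \<beta> where "I \<in> octo_units" "0 \<le> \<beta>" "x = inner 1 x *\<^sub>R 1 + \<beta> *\<^sub>R I"
proof -
  define v where "v = x - inner 1 x *\<^sub>R 1"
  have "inner 1 v = 0"
    by (simp add: v_def inner_diff_right dot_square_norm)
  \<comment> \<open>A real \<open>x\<close> lies in every slice, so for \<open>v = 0\<close> any
    unit serves.\<close>
  then have v: "\<exists>I\<in>octo_units. v = norm v *\<^sub>R I"
    using octo_units_nonempty
    by (cases "v = 0") (auto intro!: bexI[of _ "v /\<^sub>R norm v"] simp: octo_units_iff)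
  then show ?thesis
    using that[of _ "norm v"] by (auto simp: v_def algebra_simps)
qed

section \<open>Slices as copies of the complex plane\<close>

definition slice_emb :: "octo \<Rightarrow> complex \<Rightarrow> octo" where
  "slice_emb I z = Re z *\<^sub>R 1 + Im z *\<^sub>R I"

lemma bounded_linear_slice_emb: "bounded_linear (slice_emb I)"
  unfolding slice_emb_def
  by (intro bounded_linear_add bounded_linear_compose[OF bounded_linear_scaleR_left]
      bounded_linear_Re bounded_linear_Im)

lemma slice_emb_one [simp]: "slice_emb I 1 = 1"
  by (simp add: slice_emb_def)

text \<open>Powers of an octonion can thus be computed in the complex plane, inside its own
  slice.\<close>

lemma slice_emb_mult:
  assumes "I \<in> octo_units"
  shows "slice_emb I (z * w) = slice_emb I z * slice_emb I w"
proof -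
  have "I * I = - 1"
    using assms by (simp add: octo_units_def numeral_2_eq_2)
  then show ?thesis
    by (simp add: slice_emb_def octo_mult.add_left octo_mult.add_right octo_mult.scaleR_left
        octo_mult.scaleR_right algebra_simps)
qed

lemma slice_emb_power: "I \<in> octo_units \<Longrightarrow> slice_emb I (z ^ n) = slice_emb I z ^ n"
  by (induction n) (simp_all add: slice_emb_mult)

lemma norm_slice_emb:
  assumes "I \<in> octo_units"
  shows "norm (slice_emb I z) = cmod z"
proof -
  have "(norm (slice_emb I z))\<^sup>2 = (cmod z)\<^sup>2"
    using assms unfolding power2_norm_eq_inner octo_units_iff norm_eq_1
    by (simp add: slice_emb_def inner_add_left inner_add_right inner_commute
        norm_eq_1[THEN iffD1, OF octo_norm_one] inner_complex_def)
  then show ?thesis by (simp add: power2_eq_iff_nonneg)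
qed

lemma norm_octo_cis: "J \<in> octo_units \<Longrightarrow> norm (octo_cis J \<theta>) = 1"
  using norm_slice_emb[of J "cis \<theta>"] by (simp add: slice_emb_def octo_cis_def)

text \<open>Every real functional on a slice is the real part of a complex multiplication; the minus
  sign cancels the one in the real part of a product.\<close>

lemma inner_slice_emb:
  "inner (slice_emb I z) b = Re (Complex (inner 1 b) (- inner I b) * z)"
  by (simp add: slice_emb_def inner_add_left)

lemma obtain_slice_emb:
  obtains I z where "I \<in> octo_units" "x = slice_emb I z"
  using obtain_octo_unit[of x] by (metis slice_emb_def complex.sel)

subsection \<open>The coefficient bound\<close>

lemma has_integral_cis:
  "((\<lambda>t. cis (of_int m * t)) has_integral (if m = 0 then of_real (2 * pi) else 0)) {0..2 * pi}"
proof (cases "m = 0")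
  case True
  then show ?thesis
    using has_integral_const_real[of "1::complex" 0 "2 * pi"] by (simp add: scaleR_conv_of_real)
next
  case False
  have "((\<lambda>t. cis (of_int m * t)) has_integral
      (cis (of_int m * (2 * pi)) / (\<i> * of_int m) - cis (of_int m * 0) / (\<i> * of_int m)))
      {0..2 * pi}"
  proof (rule fundamental_theorem_of_calculus)
    fix t assume "t \<in> {0..2 * pi}"
    have "((\<lambda>t. exp (\<i> * of_int m * of_real t) / (\<i> * of_int m)) has_vector_derivative
        exp (\<i> * of_int m * of_real t)) (at t within {0..2 * pi})"
      using False by (auto intro!: derivative_eq_intros has_vector_derivative_real_field)
    then show "((\<lambda>t. cis (of_int m * t) / (\<i> * of_int m)) has_vector_derivative
        cis (of_int m * t)) (at t within {0..2 * pi})"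
      by (simp add: cis_conv_exp mult.assoc)
  qed simp
  moreover have "cis (of_int m * (2 * pi)) = 1"
    using cis_multiple_2pi[of "of_int m"] by (simp add: mult_ac)
  ultimately show ?thesis
    using False by simp
qed

text \<open>Absolute summability makes the series converge uniformly on the circle, so it is
  integrated term by term and orthogonality leaves the index \<open>- m\<close> alone. Only
  nonnegative frequencies occur, hence 0 for positive \<open>m\<close>.\<close>

lemma has_integral_fourier_series:
  fixes \<gamma> :: "nat \<Rightarrow> complex" and m :: int
  assumes "summable (\<lambda>n. norm (\<gamma> n))"
  shows "((\<lambda>t. (\<Sum>n. \<gamma> n * cis t ^ n) * cis (of_int m * t)) has_integral
           (if m \<le> 0 then of_real (2 * pi) * \<gamma> (nat (- m)) else 0)) {0..2 * pi}"
    (is "(?G has_integral ?c) _")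
proof -
  define P where "P N t = (\<Sum>n<N. \<gamma> n * cis t ^ n * cis (of_int m * t))" for N t
  define Q where "Q N = (\<Sum>n<N. \<gamma> n * (if int n + m = 0 then of_real (2 * pi) else 0))" for N
  have "(P N has_integral Q N) {0..2 * pi}" for N
  proof -
    have "((\<lambda>t. \<gamma> n * cis t ^ n * cis (of_int m * t)) has_integral
        \<gamma> n * (if int n + m = 0 then of_real (2 * pi) else 0)) {0..2 * pi}" for n
      using has_integral_mult_right[OF has_integral_cis[of "int n + m"], of "\<gamma> n"]
      by (simp only: Complex.DeMoivre cis_mult mult.assoc of_int_add of_int_of_nat_eq ring_distribs)
    then show ?thesis
      unfolding P_def Q_def by (intro has_integral_sum) auto
  qed
  moreover have "uniform_limit {0..2 * pi} P ?G sequentially"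
  proof -
    have "uniform_limit {0..2 * pi} (\<lambda>N t. \<Sum>n<N. \<gamma> n * cis t ^ n * cis (of_int m * t))
        (\<lambda>t. \<Sum>n. \<gamma> n * cis t ^ n * cis (of_int m * t)) sequentially"
      by (rule Weierstrass_m_test[OF _ assms]) (simp add: norm_mult norm_power)
    moreover have "(\<Sum>n. \<gamma> n * cis t ^ n * cis (of_int m * t)) = ?G t" for t
    proof (rule suminf_mult2[symmetric])
      show "summable (\<lambda>n. \<gamma> n * cis t ^ n)"
        by (rule summable_norm_cancel) (simp add: norm_mult norm_power assms)
    qed
    ultimately show ?thesis
      by (simp add: P_def[abs_def])
  qed
  ultimately obtain I J where I: "\<And>N. (P N has_integral I N) {0..2 * pi}"
    and J: "(?G has_integral J) {0..2 * pi}" and lim: "I \<longlonglongrightarrow> J"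
    by (elim uniform_limit_integral)
       (auto simp: P_def cis_conv_exp intro!: continuous_intros)
  have "I = Q"
    using I \<open>\<And>N. (P N has_integral Q N) {0..2 * pi}\<close> by (blast intro: has_integral_unique ext)
  moreover have "Q \<longlonglongrightarrow> ?c"
  \<comment> \<open>\<open>Q N\<close> no longer changes once \<open>N\<close> exceeds the only
    index that can contribute.\<close>
  proof (rule tendsto_eventually, rule eventually_sequentiallyI)
    fix N assume "nat (- m) + 1 \<le> N"
    then have "Q N = (\<Sum>n<N. if n = nat (- m) \<and> m \<le> 0 then \<gamma> n * of_real (2 * pi) else 0)"
      unfolding Q_def by (intro sum.cong) auto
    also have "\<dots> = ?c"
      using \<open>nat (- m) + 1 \<le> N\<close> by (auto simp: sum.delta mult_ac)
    finally show "Q N = ?c" .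
  qed
  ultimately show ?thesis
    using lim J LIMSEQ_unique by blast
qed

text \<open>Caratheodory's inequality, stated on the unit circle itself; smaller radii are to be
  absorbed into the coefficients.\<close>

lemma coefficient_bound:
  fixes \<gamma> :: "nat \<Rightarrow> complex"
  assumes summ: "summable (\<lambda>n. norm (\<gamma> n))"
    and le: "\<And>t. Re (\<Sum>n. \<gamma> n * cis t ^ n) \<le> M"
    and k: "k > 0"
  shows "norm (\<gamma> k) \<le> 2 * (M - Re (\<gamma> 0))"
proof -
  define G where "G t = (\<Sum>n. \<gamma> n * cis t ^ n)" for t
  define \<psi> where "\<psi> = Arg (\<gamma> k)"
  have \<gamma>: "\<gamma> k = of_real (norm (\<gamma> k)) * cis \<psi>"
    using Arg_eq[of "\<gamma> k"] by (cases "\<gamma> k = 0") (auto simp: \<psi>_def cis_conv_exp rcis_def mult_ac)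
  \<comment> \<open>Integrate \<open>M - Re G\<close> against the nonnegative kernel \<open>1 + cos (\<psi> + k t)\<close>, which isolates
    the coefficients of index \<open>0\<close> and \<open>k\<close>.\<close>
  note int = has_integral_fourier_series[OF summ, folded G_def]
  have 0: "(G has_integral of_real (2 * pi) * \<gamma> 0) {0..2 * pi}"
    using int[of 0] by simp
  have 1: "((\<lambda>t. cis (- \<psi>) * (G t * cis (- of_nat k * t))) has_integral
       cis (- \<psi>) * (of_real (2 * pi) * \<gamma> k)) {0..2 * pi}"
    using has_integral_mult_right[OF int[of "- int k"], of "cis (- \<psi>)"] by simp
  \<comment> \<open>The other half of the cosine has positive frequency and integrates to 0. So
    \<open>\<gamma> k\<close> enters with weight \<open>pi\<close> against \<open>2 * pi\<close> for
    \<open>\<gamma> 0\<close>, whence the factor 2.\<close>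
  have 2: "((\<lambda>t. cis \<psi> * (G t * cis (of_nat k * t))) has_integral 0) {0..2 * pi}"
    using has_integral_mult_right[OF int[of "int k"], of "cis \<psi>"] k by simp
  have 3: "((\<lambda>t. cis (- \<psi>) * cis (- of_nat k * t)) has_integral 0) {0..2 * pi}"
    using has_integral_mult_right[OF has_integral_cis[of "- int k"], of "cis (- \<psi>)"] k by simp
  have 4: "((\<lambda>t. 1) has_integral complex_of_real (2 * pi)) {0..2 * pi}"
    using has_integral_cis[of 0] by simp
  \<comment> \<open>One exponential suffices next to the real \<open>M\<close>, since its real part
    is already the cosine; the complex \<open>G\<close> needs both.\<close>
  have "((\<lambda>t. of_real M * (1 + cis (- \<psi>) * cis (- of_nat k * t))
        - (G t + (cis (- \<psi>) * (G t * cis (- of_nat k * t)) + cis \<psi> * (G t * cis (of_nat k * t))) / 2))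
      has_integral (of_real M * (of_real (2 * pi) + 0)
        - (of_real (2 * pi) * \<gamma> 0 + (cis (- \<psi>) * (of_real (2 * pi) * \<gamma> k) + 0) / 2))) {0..2 * pi}"
    by (intro has_integral_diff has_integral_add has_integral_mult_right has_integral_divide 0 1 2 3 4)
  from has_integral_Re[OF this] have
    "((\<lambda>t. Re (of_real M * (1 + cis (- \<psi>) * cis (- of_nat k * t))
        - (G t + (cis (- \<psi>) * (G t * cis (- of_nat k * t)) + cis \<psi> * (G t * cis (of_nat k * t))) / 2)))
      has_integral (2 * pi * (M - Re (\<gamma> 0)) - pi * norm (\<gamma> k))) {0..2 * pi}"
  proof (rule has_integral_eq_rhs)
    have "cis (- \<psi>) * \<gamma> k = of_real (norm (\<gamma> k))"
      by (subst \<gamma>) (simp add: cis_mult mult.left_commute)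
    then have "cis (- \<psi>) * (of_real (2 * pi) * \<gamma> k) = of_real (2 * pi * norm (\<gamma> k))"
      by (simp add: mult.left_commute)
    then show "2 * pi * (M - Re (\<gamma> 0)) - pi * norm (\<gamma> k) = Re (of_real M * (of_real (2 * pi) + 0)
        - (of_real (2 * pi) * \<gamma> 0 + (cis (- \<psi>) * (of_real (2 * pi) * \<gamma> k) + 0) / 2))"
      by (simp only:) (simp add: algebra_simps)
  qed
  then have "0 \<le> 2 * pi * (M - Re (\<gamma> 0)) - pi * norm (\<gamma> k)"
  proof (rule has_integral_nonneg)
    fix t assume "t \<in> {0..2 * pi}"
    have "Re (of_real M * (1 + cis (- \<psi>) * cis (- of_nat k * t))
        - (G t + (cis (- \<psi>) * (G t * cis (- of_nat k * t)) + cis \<psi> * (G t * cis (of_nat k * t))) / 2))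
      = (M - Re (G t)) * (1 + cos (\<psi> + of_nat k * t))"
      by (simp add: cos_add sin_add algebra_simps) (simp add: field_simps)
    also have "\<dots> \<ge> 0"
      using le[of t] cos_ge_minus_one[of "\<psi> + of_nat k * t"]
      unfolding G_def by (intro mult_nonneg_nonneg) linarith+
    finally show "0 \<le> Re (of_real M * (1 + cis (- \<psi>) * cis (- of_nat k * t))
        - (G t + (cis (- \<psi>) * (G t * cis (- of_nat k * t)) + cis \<psi> * (G t * cis (of_nat k * t))) / 2))" .
  qed
  then have "0 \<le> pi * (2 * (M - Re (\<gamma> 0)) - norm (\<gamma> k))"
    by (simp add: algebra_simps)
  then show ?thesis
    using pi_gt_zero by (subst (asm) zero_le_mult_iff) auto
qed


section \<open>Transfer to octonionic power series\<close>

lemma has_expansion_summable: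
  assumes f: "has_expansion f a" and r: "0 \<le> r" "r < 1"
  shows "summable (\<lambda>n. norm (a n) * r ^ n)"
proof -
  obtain I where I: "I \<in> octo_units"
    using octo_units_nonempty by blast
  \<comment> \<open>Any radius strictly between \<open>r\<close> and 1 would do: the terms are
    bounded at \<open>s\<close>, and Abel's lemma gives absolute convergence at
    \<open>r\<close>.\<close>
  define s where "s = (r + 1) / 2"
  have s: "r < s" "0 < s" "s < 1"
    using r by (simp_all add: s_def)
  define x where "x = slice_emb I (of_real s)"
  have "x \<in> octo_ball"
    using s I by (simp add: x_def norm_slice_emb)
  then have "summable (\<lambda>n. x ^ n * a n)"
    using f sums_summable by (auto simp: has_expansion_def)
  then have "Bseq (\<lambda>n. x ^ n * a n)"
    by (rule convergent_imp_Bseq[OF convergentI[OF summable_LIMSEQ_zero]])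
  then obtain K where "\<And>n. norm (x ^ n * a n) \<le> K"
    by (auto elim!: BseqE)
  moreover have "norm (x ^ n * a n) = norm (a n) * s ^ n" for n
    using s I by (simp add: x_def octo_norm_mult norm_slice_emb norm_power flip: slice_emb_power)
  ultimately show ?thesis
    using Abel_lemma[OF r(1) s(1)] by metis
qed

lemma octo_coefficient_bound:
  assumes le: "\<And>x. x \<in> octo_ball \<Longrightarrow> norm (f x) \<le> 1"
    and f: "has_expansion f a"
    and k: "k > 0"
  shows "norm (a k) \<le> 2 * (1 - norm (a 0))"
proof -
  \<comment> \<open>If \<open>a 0\<close> vanishes it has no direction, and \<open>u = 1\<close>
    serves.\<close>
  obtain u where u: "norm u = 1" "a 0 = norm (a 0) *\<^sub>R u"
  proof (cases "a 0 = 0")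
    case True
    then show ?thesis using that[of 1] by simp
  next
    case False
    then show ?thesis using that[of "a 0 /\<^sub>R norm (a 0)"] by simp
  qed
  define b where "b n = u * octo_cnj (a n)" for n
  have norm_b: "norm (b n) = norm (a n)" for n
    by (simp add: b_def octo_norm_mult u)
  \<comment> \<open>The slice depends on \<open>k\<close>: as \<open>b k\<close> lies in it, passing
    to the complex coefficient \<open>B k\<close> loses nothing of its modulus.\<close>
  obtain I \<beta> where I: "I \<in> octo_units" and bk: "b k = inner 1 (b k) *\<^sub>R 1 + \<beta> *\<^sub>R I"
    using obtain_octo_unit[of "b k"] by metis
  define B where "B n = Complex (inner 1 (b n)) (- inner I (b n))" for n
  have "inner I (b k) = \<beta>"
    using I by (subst bk) (simp add: octo_units_iff inner_add_right inner_commute dot_square_norm)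
  then have Bk: "norm (B k) = norm (a k)"
    using norm_slice_emb[OF I, of "cnj (B k)"] bk
    by (simp add: B_def slice_emb_def norm_b)
  have "inner 1 (b 0) = norm (a 0)"
    using octo_inner_mult[of 1 "a 0" u] u
    by (simp add: b_def) (metis inner_scaleR_left dot_square_norm mult.right_neutral power_one)
  then have B0: "Re (B 0) = norm (a 0)"
    by (simp add: B_def)
  \<comment> \<open>For the other indices part of \<open>b n\<close> may be orthogonal to the slice;
    this crude bound only serves summability.\<close>
  have B_le: "norm (B n) \<le> 2 * norm (a n)" for n
  proof -
    have "\<bar>inner 1 (b n)\<bar> \<le> norm (b n)" "\<bar>inner I (b n)\<bar> \<le> norm (b n)"
      using Cauchy_Schwarz_ineq2[of 1 "b n"] Cauchy_Schwarz_ineq2[of I "b n"] I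
      by (simp_all add: octo_units_iff)
    then show ?thesis
      using cmod_le[of "B n"] by (simp add: B_def norm_b)
  qed
  \<comment> \<open>The circle of radius \<open>s\<close> stays inside the ball, at the cost of the
    factor \<open>s ^ k\<close>.\<close>
  have *: "s ^ k * norm (a k) \<le> 2 * (1 - norm (a 0))" if s: "0 < s" "s < 1" for s :: real
  proof -
    define \<gamma> where "\<gamma> n = of_real (s ^ n) * B n" for n
    have \<gamma>: "summable (\<lambda>n. norm (\<gamma> n))"
    proof (rule summable_comparison_test')
      show "summable (\<lambda>n. 2 * (norm (a n) * s ^ n))"
        using has_expansion_summable[OF f, of s] s by (intro summable_mult) auto
      show "norm (norm (\<gamma> n)) \<le> 2 * (norm (a n) * s ^ n)" if "n \<ge> 0" for n
        using mult_left_mono[OF B_le[of n], of "s ^ n"] s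
        by (simp add: \<gamma>_def norm_mult norm_power mult_ac)
    qed
    have "norm (\<gamma> k) \<le> 2 * (1 - Re (\<gamma> 0))"
    proof (rule coefficient_bound[OF \<gamma> _ k])
      fix t
      define x where "x = slice_emb I (of_real s * cis t)"
      have x: "x \<in> octo_ball"
        using s I by (simp add: x_def norm_slice_emb norm_mult)
      have "(\<lambda>n. inner (x ^ n * a n) u) sums inner (f x) u"
        using f x by (intro bounded_linear.sums[OF bounded_linear_inner_left])
          (simp add: has_expansion_def)
      moreover have "inner (x ^ n * a n) u = Re (\<gamma> n * cis t ^ n)" for n
        using I by (simp add: x_def octo_inner_mult inner_slice_emb b_def[symmetric] B_def[symmetric]
            \<gamma>_def power_mult_distrib mult_ac flip: slice_emb_power)
      moreover have "summable (\<lambda>n. \<gamma> n * cis t ^ n)"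
        by (rule summable_norm_cancel) (simp add: norm_mult norm_power \<gamma>)
      then have "(\<lambda>n. Re (\<gamma> n * cis t ^ n)) sums Re (\<Sum>n. \<gamma> n * cis t ^ n)"
        by (intro sums_Re summable_sums)
      ultimately have "Re (\<Sum>n. \<gamma> n * cis t ^ n) = inner (f x) u"
        using sums_unique2 by fastforce
      also have "\<dots> \<le> 1"
        using norm_cauchy_schwarz[of "f x" u] le[OF x] u by simp
      finally show "Re (\<Sum>n. \<gamma> n * cis t ^ n) \<le> 1" .
    qed
    then show ?thesis
      using s by (simp add: \<gamma>_def norm_mult norm_power Bk B0)
  qed
  show ?thesis
  \<comment> \<open>Letting \<open>s\<close> tend to 1 removes the factor;
    \<open>s = root k z\<close> makes it equal to \<open>z\<close>.\<close>
  proof (rule field_le_mult_one_interval)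
    fix z :: real assume "0 < z" "z < 1"
    then show "z * norm (a k) \<le> 2 * (1 - norm (a 0))"
      using *[of "root k z"] k by simp
  qed
qed

subsection \<open>Majorant series\<close>

lemma dft_majorant_sums:
  assumes "J \<in> octo_units" "0 \<le> r" "r < 1" "summable (\<lambda>n. norm (a n) * r ^ n)"
  shows "dft_majorant_term J a r sums ((\<Sum>n. norm (a n) * r ^ n) / (1 - r))"
proof -
  have "(\<lambda>n. \<Sum>k\<le>n. norm (a k) * r ^ k * r ^ (n - k)) sums
      ((\<Sum>n. norm (a n) * r ^ n) * (\<Sum>n. r ^ n))"
    using assms by (intro Cauchy_product_sums) (simp_all add: summable_geometric)
  moreover have "(\<Sum>k\<le>n. norm (a k) * r ^ k * r ^ (n - k)) = dft_majorant_term J a r n" for n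
    using assms(1)
    by (simp add: dft_majorant_term_def octo_norm_mult norm_octo_cis sum_distrib_left mult.assoc
        mult.commute[of "r ^ n"] flip: power_add)
  ultimately show ?thesis
    using assms by (simp add: suminf_geometric)
qed

text \<open>The tail is at most 2 (1 - |a 0|) times the sum of 3^(-n) over n >= 1. That sum is 1/2,
  so the tail is at most 1 - |a 0|, exactly the room left by the constant term.\<close>

lemma octo_bohr:
  assumes f: "f \<in> SRB" "has_expansion f a" and r: "0 \<le> r" "r \<le> 1 / 3"
  shows "(\<Sum>n. norm (a n) * r ^ n) \<le> 1"
proof -
  let ?A = "norm (a 0)"
  have bound: "norm (a k) \<le> 2 * (1 - ?A)" if "k > 0" for k
    using octo_coefficient_bound[of f a k] f that by (auto simp: SRB_def)
  have summ: "summable (\<lambda>n. norm (a n) * r ^ n)"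
    using has_expansion_summable[OF f(2)] r by simp
  have geo: "(\<lambda>n. 2 * (1 - ?A) / 3 * (1 / 3) ^ n) sums (2 * (1 - ?A) / 3 * (1 / (1 - 1 / 3)))"
    by (intro sums_mult geometric_sums) simp
  have "(\<Sum>n. norm (a (Suc n)) * r ^ Suc n) \<le> (\<Sum>n. 2 * (1 - ?A) / 3 * (1 / 3) ^ n)"
  proof (rule suminf_le)
    fix n
    have "norm (a (Suc n)) * r ^ Suc n \<le> 2 * (1 - ?A) * (1 / 3) ^ Suc n"
      using bound[of "Suc n"] norm_ge_zero[of "a (Suc n)"] r
      by (intro mult_mono power_mono) (auto intro: order_trans simp del: norm_ge_zero)
    then show "norm (a (Suc n)) * r ^ Suc n \<le> 2 * (1 - ?A) / 3 * (1 / 3) ^ n"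
      by simp
  next
    show "summable (\<lambda>n. norm (a (Suc n)) * r ^ Suc n)"
      using summ by (subst summable_Suc_iff)
  qed (use geo sums_summable in blast)
  also have "\<dots> = 1 - ?A"
    using sums_unique[OF geo] by simp
  finally show ?thesis
    using suminf_split_head[OF summ] by simp
qed

subsection \<open>Slice regular functions with real coefficients\<close>

text \<open>The derivative is \<open>L\<close> after multiplication by \<open>deriv g z\<close>,
  which is continuous in \<open>z\<close> because \<open>deriv g\<close> is again holomorphic.
  \<open>L\<close> is only real linear, so real and imaginary parts are covered.\<close>

lemma C1_on_bounded_linear_holomorphic:
  assumes L: "bounded_linear L" and g: "g holomorphic_on S" and S: "open S"
  shows "C1_on S (\<lambda>z. L (g z))"
  unfolding C1_on_def
proof (intro exI conjI ballI)
  let ?F = "\<lambda>z. Blinfun L o\<^sub>L blinfun_mult_right (deriv g z)"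
  show "continuous_on S ?F"
    by (intro continuous_intros bounded_linear.continuous_on[OF bounded_linear_blinfun_mult_right]
        holomorphic_on_imp_continuous_on holomorphic_deriv g S)
  fix z assume "z \<in> S"
  then have "(g has_derivative (*) (deriv g z)) (at z)"
    using holomorphic_derivI[OF g S] by (simp add: has_field_derivative_def)
  from bounded_linear.has_derivative[OF L this]
  show "((\<lambda>z. L (g z)) has_derivative blinfun_apply (?F z)) (at z)"
    by (simp add: blinfun_compose.rep_eq o_def bounded_linear_Blinfun_apply[OF L])
qed

text \<open>Chain rule along the two coordinate lines, whose tangents are 1 and \<open>\<i>\<close>.
  For real and imaginary parts the factor \<open>\<i>\<close> yields the Cauchy-Riemann
  equations.\<close>

lemma
  assumes L: "bounded_linear L" and g: "(g has_field_derivative g') (at z)"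
  shows d_alpha_bounded_linear: "d_alpha (\<lambda>z. L (g z)) z = L g'"
    and d_beta_bounded_linear: "d_beta (\<lambda>z. L (g z)) z = L (\<i> * g')"
proof -
  have "((\<lambda>t. Complex t (Im z)) has_vector_derivative 1) (at (Re z))"
    "((\<lambda>t. Complex (Re z) t) has_vector_derivative \<i>) (at (Im z))"
    unfolding Complex_eq by (auto intro!: derivative_eq_intros)
  from this[THEN field_vector_diff_chain_at, of g g'] g
  have "((\<lambda>t. g (Complex t (Im z))) has_vector_derivative g') (at (Re z))"
    "((\<lambda>t. g (Complex (Re z) t)) has_vector_derivative \<i> * g') (at (Im z))"
    by (simp_all add: o_def)
  from this[THEN bounded_linear.has_vector_derivative[OF L]]
  show "d_alpha (\<lambda>z. L (g z)) z = L g'" "d_beta (\<lambda>z. L (g z)) z = L (\<i> * g')"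
    unfolding d_alpha_def d_beta_def by (simp_all add: vector_derivative_at)
qed

text \<open>Real coefficients make the octonionic series map each slice to itself and act there as
  \<open>g\<close>. Hence the norm bound carries over, and the stem components are the real and
  imaginary parts of \<open>g\<close>.\<close>

lemma SRB_real_power_series:
  fixes c :: "nat \<Rightarrow> real"
  assumes sums: "\<And>z. cmod z < 1 \<Longrightarrow> (\<lambda>n. of_real (c n) * z ^ n) sums g z"
    and le: "\<And>z. cmod z < 1 \<Longrightarrow> cmod (g z) \<le> 1"
  obtains f where "f \<in> SRB" "has_expansion f (\<lambda>n. c n *\<^sub>R 1)"
proof -
  define f :: "octo \<Rightarrow> octo" where "f x = (\<Sum>n. x ^ n * (c n *\<^sub>R 1))" for x
  have exp: "(\<lambda>n. slice_emb I z ^ n * (c n *\<^sub>R 1)) sums slice_emb I (g z)"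
    if "cmod z < 1" "I \<in> octo_units" for I z
    using bounded_linear.sums[OF bounded_linear_slice_emb sums[OF that(1)], of I] that(2)
    by (simp add: octo_mult.scaleR_right slice_emb_power[symmetric] scaleR_conv_of_real[symmetric]
        linear_scale[OF bounded_linear.linear[OF bounded_linear_slice_emb]])
  have f_emb: "f (slice_emb I z) = slice_emb I (g z)"
    if "cmod z < 1" "I \<in> octo_units" for I z
    unfolding f_def by (rule sums_unique[OF exp[OF that], symmetric])
  have "has_expansion f (\<lambda>n. c n *\<^sub>R 1)"
    unfolding has_expansion_def
  proof
    fix x :: octo assume x: "x \<in> octo_ball"
    obtain I z where "I \<in> octo_units" "x = slice_emb I z"
      by (rule obtain_slice_emb)
    then show "(\<lambda>n. x ^ n * (c n *\<^sub>R 1)) sums f x"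
      using x exp f_emb by (simp add: norm_slice_emb)
  qed
  moreover have "norm (f x) \<le> 1" if x: "x \<in> octo_ball" for x
  proof -
    obtain I z where "I \<in> octo_units" "x = slice_emb I z"
      by (rule obtain_slice_emb)
    then show ?thesis
      using x le f_emb by (simp add: norm_slice_emb)
  qed
  moreover have "slice_regular f"
    unfolding slice_regular_def
  proof (intro exI conjI)
    let ?L1 = "\<lambda>w. Re w *\<^sub>R (1::octo)" and ?L2 = "\<lambda>w. Im w *\<^sub>R (1::octo)"
    have L: "bounded_linear ?L1" "bounded_linear ?L2"
      by (intro bounded_linear_compose[OF bounded_linear_scaleR_left] bounded_linear_Re
          bounded_linear_Im)+
    have disk: "cdisk = ball 0 1" "open cdisk"
      by (auto simp: dist_norm open_Collect_less continuous_on_norm_id)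
    have g: "g holomorphic_on cdisk"
      unfolding disk(1) by (rule power_series_holomorphic[of _ _ "\<lambda>n. of_real (c n)"]) (simp add: sums)
    show "C1_on cdisk (\<lambda>z. ?L1 (g z))" "C1_on cdisk (\<lambda>z. ?L2 (g z))"
      by (rule C1_on_bounded_linear_holomorphic; fact L g disk)+
    show "cauchy_riemann (\<lambda>z. ?L1 (g z)) (\<lambda>z. ?L2 (g z))"
      unfolding cauchy_riemann_def
    proof
      fix z assume "z \<in> cdisk"
      note der = holomorphic_derivI[OF g disk(2) this]
      show "d_alpha (\<lambda>z. ?L1 (g z)) z = d_beta (\<lambda>z. ?L2 (g z)) z \<and>
        d_beta (\<lambda>z. ?L1 (g z)) z = - d_alpha (\<lambda>z. ?L2 (g z)) z"
        by (simp add: d_alpha_bounded_linear[OF L(1) der] d_beta_bounded_linear[OF L(1) der]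
            d_alpha_bounded_linear[OF L(2) der] d_beta_bounded_linear[OF L(2) der])
    qed
    \<comment> \<open>Real coefficients give this symmetry, which is the parity required of the stem
      function.\<close>
    have "g (cnj z) = cnj (g z)" if "cmod z < 1" for z
    proof (rule sums_unique2)
      show "(\<lambda>n. of_real (c n) * cnj z ^ n) sums g (cnj z)"
        using that by (intro sums) simp
      show "(\<lambda>n. of_real (c n) * cnj z ^ n) sums cnj (g z)"
        using sums_cnj[THEN iffD2, OF sums[OF that]] by simp
    qed
    then show "stem_function (\<lambda>z. ?L1 (g z)) (\<lambda>z. ?L2 (g z))"
      by (simp add: stem_function_def)
    show "induces (\<lambda>z. ?L1 (g z)) (\<lambda>z. ?L2 (g z)) f"
      unfolding induces_def
    proof (intro ballI allI impI)
      fix I \<alpha> \<beta> assume "I \<in> octo_units" "Complex \<alpha> \<beta> \<in> cdisk"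
      then show "f (\<alpha> *\<^sub>R 1 + \<beta> *\<^sub>R I) = ?L1 (g (Complex \<alpha> \<beta>)) + I * ?L2 (g (Complex \<alpha> \<beta>))"
        using f_emb[of "Complex \<alpha> \<beta>" I] by (simp add: slice_emb_def octo_mult.scaleR_right)
    qed
  qed
  ultimately show ?thesis
    using that[of f] by (simp add: SRB_def)
qed

section \<open>Moebius functions and sharpness of \<open>1/3\<close>\<close>

lemma moebius_sums:
  fixes p z :: complex
  assumes "cmod (p * z) < 1"
  shows "(\<lambda>n. (if n = 0 then p else - (1 - p\<^sup>2) * p ^ (n - 1)) * z ^ n) sums ((p - z) / (1 - p * z))"
    (is "?F sums _")
proof -
  have "1 - p * z \<noteq> 0"
    using assms by auto
  \<comment> \<open>After the constant \<open>p\<close> is split off, the rest is a geometric series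
    times \<open>z\<close>, hence the exponent \<open>n - 1\<close>.\<close>
  then have eq: "- (1 - p\<^sup>2) * z * (1 / (1 - p * z)) = (p - z) / (1 - p * z) - p"
    by (simp add: field_simps power2_eq_square)
  have "(\<lambda>n. - (1 - p\<^sup>2) * z * (p * z) ^ n) sums ((p - z) / (1 - p * z) - p)"
    using sums_mult[OF geometric_sums[OF assms], of "- (1 - p\<^sup>2) * z"] by (simp only: eq)
  then have "(\<lambda>n. ?F (Suc n)) sums ((p - z) / (1 - p * z) - p)"
    by (simp add: power_mult_distrib mult_ac)
  from sums_Suc[OF this] show ?thesis
    by simp
qed

lemma norm_moebius_le_1:
  fixes p :: real
  assumes "\<bar>p\<bar> \<le> 1" "cmod z \<le> 1"
  shows "cmod ((of_real p - z) / (1 - of_real p * z)) \<le> 1"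
proof -
  have "(cmod (1 - of_real p * z))\<^sup>2 - (cmod (of_real p - z))\<^sup>2 = (1 - p\<^sup>2) * (1 - (cmod z)\<^sup>2)"
    unfolding cmod_power2 by (simp add: power2_eq_square algebra_simps)
  also have "\<dots> \<ge> 0"
    using assms by (intro mult_nonneg_nonneg) (simp_all add: abs_square_le_1)
  finally have "cmod (of_real p - z) \<le> cmod (1 - of_real p * z)"
    by (intro power2_le_imp_le[OF _ norm_ge_zero]) simp
  then show ?thesis
    by (simp add: norm_divide divide_le_eq_1)
qed

lemma octo_bohr_sharp:
  assumes r: "1 / 3 < r" "r < 1"
  obtains f a where "f \<in> SRB" "has_expansion f a"
    "summable (\<lambda>n. norm (a n) * r ^ n)" "(\<Sum>n. norm (a n) * r ^ n) > 1"
proof -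
  \<comment> \<open>The condition \<open>1 < r * (1 + 2 * p)\<close> means that \<open>p\<close>
    exceeds this number; it lies below 1 precisely because \<open>r > 1 / 3\<close>.\<close>
  have "(1 / r - 1) / 2 < 1"
    using r by (simp add: field_simps)
  then obtain p where "(1 / r - 1) / 2 < p" "p < 1"
    using dense by blast
  moreover have "(1 / r - 1) / 2 > 0"
    using r by simp
  ultimately have p: "0 < p" "p < 1" "1 < r * (1 + 2 * p)"
    using r by (linarith, blast, simp add: field_simps)
  define c where "c n = (if n = 0 then p else - (1 - p\<^sup>2) * p ^ (n - 1))" for n
  have pz: "cmod (of_real p * z) < 1" if "cmod z < 1" for z
    using mult_strict_mono[of p 1 "cmod z" 1] p that by (simp add: norm_mult)
  have "(\<lambda>n. of_real (c n) * z ^ n) sums ((of_real p - z) / (1 - of_real p * z))"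
    if "cmod z < 1" for z
    using moebius_sums[OF pz[OF that]] by (simp add: c_def if_distrib cong: if_cong)
  then obtain f where f: "f \<in> SRB" "has_expansion f (\<lambda>n. c n *\<^sub>R 1)"
    using norm_moebius_le_1[of p] p by (elim SRB_real_power_series) auto
  have pr: "\<bar>p * r\<bar> < 1"
    using mult_strict_mono[of p 1 r 1] p r by simp
  have "(\<lambda>n. (1 - p\<^sup>2) * r * (p * r) ^ n) sums ((1 - p\<^sup>2) * r * (1 / (1 - p * r)))"
    using pr by (intro sums_mult geometric_sums) simp
  moreover have "norm (c (Suc n) *\<^sub>R (1::octo)) * r ^ Suc n = (1 - p\<^sup>2) * r * (p * r) ^ n" for n
    using p by (simp add: c_def abs_mult power_mult_distrib power_le_one)
  ultimately have "(\<lambda>n. norm (c (Suc n) *\<^sub>R (1::octo)) * r ^ Suc n) sums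
      ((1 - p\<^sup>2) * r * (1 / (1 - p * r)))"
    by (simp only:)
  from sums_Suc[OF this] have "(\<lambda>n. norm (c n *\<^sub>R (1::octo)) * r ^ n) sums
      ((1 - p\<^sup>2) * r * (1 / (1 - p * r)) + p)"
    using p by (simp add: c_def)
  \<comment> \<open>Clearing the denominator and cancelling \<open>1 - p\<close> reduces this to
    \<open>r * (1 + p) > 1 - p * r\<close>, the condition on \<open>p\<close>.\<close>
  moreover have "(1 - p\<^sup>2) * r * (1 / (1 - p * r)) + p > 1"
  proof -
    have "(1 - p) * (r * (1 + 2 * p)) > (1 - p) * 1"
      using p by (intro mult_strict_left_mono) auto
    then show ?thesis
      using pr by (simp add: field_simps power2_eq_square)
  qed
  ultimately show ?thesis
    using that[OF f] by (simp add: sums_iff)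
qed

text \<open>Summability is claimed in both halves, since \<open>suminf\<close> of a divergent series
  is an unspecified value. For each \<open>r\<close> a single \<open>f\<close> serves all
  \<open>J\<close> and \<open>x\<close>.\<close>

theorem theorem2p3:
  shows "(\<forall>f\<in>SRB. \<forall>a. has_expansion f a \<longrightarrow>
            (\<forall>J\<in>octo_units. \<forall>x\<in>octo_ball \<inter> octo_slice J. norm x \<le> 1 / 3 \<longrightarrow>
               summable (dft_majorant_term J a (norm x)) \<and>
               (\<Sum>n. dft_majorant_term J a (norm x) n) \<le> 1 / (1 - norm x)))
       \<and> (\<forall>r::real. 1 / 3 < r \<and> r < 1 \<longrightarrow>
            (\<exists>f\<in>SRB. \<exists>a. has_expansion f a \<and>
               (\<forall>J\<in>octo_units. \<forall>x\<in>octo_ball \<inter> octo_slice J. norm x = r \<longrightarrow>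
                  summable (dft_majorant_term J a (norm x)) \<and>
                  \<not> (\<Sum>n. dft_majorant_term J a (norm x) n) \<le> 1 / (1 - norm x))))"
proof (intro conjI ballI allI impI)
  fix f a J x
  assume "f \<in> SRB" "has_expansion f a" "J \<in> octo_units" "norm x \<le> 1 / 3"
  then have "dft_majorant_term J a (norm x) sums ((\<Sum>n. norm (a n) * norm x ^ n) / (1 - norm x))"
    and "(\<Sum>n. norm (a n) * norm x ^ n) \<le> 1"
    by (simp_all add: dft_majorant_sums has_expansion_summable octo_bohr)
  then show "summable (dft_majorant_term J a (norm x))"
    and "(\<Sum>n. dft_majorant_term J a (norm x) n) \<le> 1 / (1 - norm x)"
    using \<open>norm x \<le> 1 / 3\<close> by (auto simp: sums_iff divide_right_mono)
next
  fix r :: real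
  assume r: "1 / 3 < r \<and> r < 1"
  then obtain f a where f: "f \<in> SRB" "has_expansion f a"
    and a: "summable (\<lambda>n. norm (a n) * r ^ n)" "(\<Sum>n. norm (a n) * r ^ n) > 1"
    using octo_bohr_sharp by blast
  have "summable (dft_majorant_term J a r) \<and>
      \<not> (\<Sum>n. dft_majorant_term J a r n) \<le> 1 / (1 - r)" if "J \<in> octo_units" for J
    using dft_majorant_sums[OF that _ _ a(1)] a(2) r by (simp add: sums_iff divide_le_cancel)
  with f show "\<exists>f\<in>SRB. \<exists>a. has_expansion f a \<and>
      (\<forall>J\<in>octo_units. \<forall>x\<in>octo_ball \<inter> octo_slice J. norm x = r \<longrightarrow>
        summable (dft_majorant_term J a (norm x)) \<and>
        \<not> (\<Sum>n. dft_majorant_term J a (norm x) n) \<le> 1 / (1 - norm x))"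
    by blast
qed

end
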